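(* Let $H=(U,\mathcal{C})$ be a finite hypergraph with dual hypergraph $H^*$, which has vertices $\{v_C : C\in\mathcal{C}\}$ and hyperedges $\{e_u : u\in U\}$. Let $\mathcal{X}_u$ ($u\in U$) be finite nonempty sets and let $\mathbb{K}$ be a field. Then the data of a discrete graphical model on $H$ with state spaces $\mathcal{X}_u$, i.e. a family of clique potentials $\psi_C:\prod_{u\in C}\mathcal{X}_u\to\mathbb{K}$ ($C\in\mathcal{C}$), is the same as the data of a tensor hypernetwork on $H^*$ in which the hyperedge $e_u$ has size $|\mathcal{X}_u|$, with tensor $T_C=\psi_C$ at the vertex $v_C$. That is, $(\psi_C)_{C\in\mathcal{C}}\mapsto(T_C)_{C\in\mathcal{C}}$, $T_C=\psi_C$, is a well-defined bijection from families of clique potentials on $H$ with state spaces $\mathcal{X}_u$ to families of tensors $T_C\in\bigotimes_{e_u\ni v_C}\mathbb{K}^{|\mathcal{X}_u|}$ defining a tensor hypernetwork on $H^*$ with sizes $n_{e_u}=|\mathcal{X}_u|$.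
   Context: A (finite) hypergraph $H=(U,\mathcal{C})$ consists of a finite set $U$ of vertices and a finite family $\mathcal{C}$ of hyperedges, each hyperedge being a subset of $U$. Nested or repeated hyperedges, and hyperedges containing one or no vertices, are allowed. Its incidence matrix $M$ has rows indexed by $U$, columns indexed by $\mathcal{C}$, and $M_{uC}=1$ if $u\in C$, $0$ otherwise. The dual hypergraph $H^*$ is the hypergraph with incidence matrix $M^T$: its vertices are $\{v_C: C\in\mathcal{C}\}$, its hyperedges are $\{e_u: u\in U\}$, and $v_C\in e_u$ if and only if $u\in C$. Discrete graphical model on $H$: each $u\in U$ carries a variable $X_u$ with values in a finite set $\mathcal{X}_u$; the data is a clique potential $\psi_C$, a function on $\prod_{u\in C}\mathcal{X}_u$, for each $C\in\mathcal{C}$. (For probability distributions the potentials take values in $\mathbb{R}_{\ge 0}$; here values in a field $\mathbb{K}$ are allowed.) The associated joint tensor is $P(x)=\frac1Z\prod_{C\in\mathcal{C}}\psi_C(x_C)$, where $x_C=(x_u)_{u\in C}$ and $Z$ is the normalizing constant. Tensor hypernetwork on a hypergraph $G=(V,E)$: each hyperedge $e\in E$ carries a positive integer $n_e$ (its size), and each vertex $v\in V$ carries a tensor $T_v\in\bigotimes_{e\ni v}\mathbb{K}^{n_e}$. A function $\prod_{u\in C}\mathcal{X}_u\to\mathbb{K}$ is identified with a tensor in $\bigotimes_{u\in C}\mathbb{K}^{|\mathcal{X}_u|}$ by taking the elements of $\mathcal{X}_u$ as index set for the coordinates of $\mathbb{K}^{|\mathcal{X}_u|}$. *)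

theory Defs
  imports Complex_Main "HOL-Library.FuncSet" "HOL-Library.Function_Algebras"
begin

(* Hyperedges are labels; the label C stands for the vertex set members H C.  Hence the
   hyperedges form a family: distinct labels may carry the same vertex set. *)
record ('v, 'e) hypergraph =
  verts :: "'v set"
  hyperedges :: "'e set"
  members :: "'e \<Rightarrow> 'v set"

definition finite_hypergraph :: "('v, 'e) hypergraph \<Rightarrow> bool" where
  "finite_hypergraph H \<longleftrightarrow>
     finite (verts H) \<and> finite (hyperedges H) \<and> (\<forall>C\<in>hyperedges H. members H C \<subseteq> verts H)"

definition incidence_matrix :: "('v, 'e) hypergraph \<Rightarrow> 'v \<Rightarrow> 'e \<Rightarrow> nat" where
  "incidence_matrix H u C = (if u \<in> members H C then 1 else 0)"

(* The label C is reused as the name of the dual vertex v_C, and the vertex u as the label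
   of the dual hyperedge e_u. *)
definition dual :: "('v, 'e) hypergraph \<Rightarrow> ('e, 'v) hypergraph" where
  "dual H = \<lparr>verts = hyperedges H, hyperedges = verts H,
             members = (\<lambda>u. {C \<in> hyperedges H. u \<in> members H C})\<rparr>"

lemma incidence_matrix_dual:
  "C \<in> hyperedges H \<Longrightarrow> incidence_matrix (dual H) C u = incidence_matrix H u C"
  by (simp add: incidence_matrix_def dual_def)

lemma finite_hypergraph_dual: "finite_hypergraph H \<Longrightarrow> finite_hypergraph (dual H)"
  by (auto simp: finite_hypergraph_def dual_def)

definition incident :: "('v, 'e) hypergraph \<Rightarrow> 'v \<Rightarrow> 'e set" where
  "incident G v = {e \<in> hyperedges G. v \<in> members G e}"

definition clique_potentials ::
  "('u, 'c) hypergraph \<Rightarrow> ('u \<Rightarrow> 'x set) \<Rightarrow> ('c \<Rightarrow> ('u \<Rightarrow> 'x) \<Rightarrow> 'k::field) set" where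
  "clique_potentials H X =
     (\<Pi>\<^sub>E C\<in>hyperedges H. (\<Pi>\<^sub>E u\<in>members H C. X u) \<rightarrow>\<^sub>E UNIV)"


definition fun_scale :: "'k::field \<Rightarrow> ('a \<Rightarrow> 'k) \<Rightarrow> 'a \<Rightarrow> 'k" where
  "fun_scale c f = (\<lambda>a. c * f a)"

global_interpretation fun_vs: vector_space fun_scale
  by unfold_locales (auto simp: fun_scale_def algebra_simps)

definition point_fun :: "'a \<Rightarrow> 'a \<Rightarrow> 'k::field" where
  "point_fun a = (\<lambda>b. if b = a then 1 else 0)"

(* The coordinate space K^A; for card A = n this is K^n with coordinates indexed by A. *)
definition coord_space :: "'a set \<Rightarrow> ('a \<Rightarrow> 'k::field) set" where
  "coord_space A = {v. \<forall>a. a \<notin> A \<longrightarrow> v a = 0}"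

(* The tensor product of a family V of spaces indexed by I is the free vector space on the
   Cartesian product of the family, modulo the relations of multilinearity.  A formal linear
   combination of tuples is its coefficient function, so point_fun t is the generator t. *)
definition free_space :: "'i set \<Rightarrow> ('i \<Rightarrow> ('a \<Rightarrow> 'k::field) set) \<Rightarrow> (('i \<Rightarrow> 'a \<Rightarrow> 'k) \<Rightarrow> 'k) set" where
  "free_space I V = fun_vs.span (point_fun ` Pi\<^sub>E I V)"

definition multilinear_relations ::
  "'i set \<Rightarrow> ('i \<Rightarrow> ('a \<Rightarrow> 'k::field) set) \<Rightarrow> (('i \<Rightarrow> 'a \<Rightarrow> 'k) \<Rightarrow> 'k) set" where
  "multilinear_relations I V =
     {point_fun (t(i := v + w)) - point_fun (t(i := v)) - point_fun (t(i := w)) | t i v w.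
        t \<in> Pi\<^sub>E I V \<and> i \<in> I \<and> v \<in> V i \<and> w \<in> V i} \<union>
     {point_fun (t(i := fun_scale c v)) - fun_scale c (point_fun (t(i := v))) | t i c v.
        t \<in> Pi\<^sub>E I V \<and> i \<in> I \<and> v \<in> V i}"

definition tensor_rel ::
  "'i set \<Rightarrow> ('i \<Rightarrow> ('a \<Rightarrow> 'k::field) set) \<Rightarrow> ((('i \<Rightarrow> 'a \<Rightarrow> 'k) \<Rightarrow> 'k) \<times> (('i \<Rightarrow> 'a \<Rightarrow> 'k) \<Rightarrow> 'k)) set" where
  "tensor_rel I V = {(f, g). f \<in> free_space I V \<and> g \<in> free_space I V \<and>
                             f - g \<in> fun_vs.span (multilinear_relations I V)}"

definition tensor_product ::
  "'i set \<Rightarrow> ('i \<Rightarrow> ('a \<Rightarrow> 'k::field) set) \<Rightarrow> (('i \<Rightarrow> 'a \<Rightarrow> 'k) \<Rightarrow> 'k) set set" where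
  "tensor_product I V = free_space I V // tensor_rel I V"

(* Identification of a function f on the product of the A i, i in I, with the tensor having
   f x as its entry at the multi-index x, i.e. the sum over x of f x times the tensor product
   of the standard basis vectors with indices x i.  Sums in the quotient are taken on
   representatives. *)
definition tensor_of_fun ::
  "'i set \<Rightarrow> ('i \<Rightarrow> 'a set) \<Rightarrow> (('i \<Rightarrow> 'a) \<Rightarrow> 'k::field) \<Rightarrow> (('i \<Rightarrow> 'a \<Rightarrow> 'k) \<Rightarrow> 'k) set" where
  "tensor_of_fun I A f =
     tensor_rel I (\<lambda>i. coord_space (A i)) ``
       {\<Sum>x\<in>Pi\<^sub>E I A. fun_scale (f x) (point_fun (\<lambda>i\<in>I. point_fun (x i)))}"


(* Tensor hypernetworks on G with sizes n, where the coordinates of K^(n e) are indexed by the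
   set J e of n e elements. *)
definition tensor_hypernetworks ::
  "('v, 'e) hypergraph \<Rightarrow> ('e \<Rightarrow> nat) \<Rightarrow> ('e \<Rightarrow> 'a set) \<Rightarrow>
   ('v \<Rightarrow> (('e \<Rightarrow> 'a \<Rightarrow> 'k::field) \<Rightarrow> 'k) set) set" where
  "tensor_hypernetworks G n J =
     {T. finite_hypergraph G \<and>
         (\<forall>e\<in>hyperedges G. n e > 0 \<and> finite (J e) \<and> card (J e) = n e) \<and>
         T \<in> (\<Pi>\<^sub>E v\<in>verts G. tensor_product (incident G v) (\<lambda>e. coord_space (J e)))}"

end

theory Submission
  imports Defs
begin

(* A tensor product of finite-dimensional coordinate spaces has the tensor products of standard
   basis vectors as a basis, so the coordinates of a tensor form an arbitrary function on the
   product of the index sets.  They are independent because the coordinate functionals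
   t \<mapsto> \<Prod>i. t i (x i) are multilinear and hence vanish on the relations; they span because
   any factor of a pure tensor may be expanded in the standard basis modulo the relations.
   Since the dual hyperedges through v_C are the e_u with u in C, applying this to each C
   gives the theorem. *)

text \<open>The inverse acts componentwise as well. Both maps are restricted to \<open>I\<close>, so
  extensionality makes them mutually inverse off \<open>I\<close> too. It serves to combine the
  bijections found for the single cliques.\<close>

lemma bij_betw_PiE_pointwise:
  assumes "\<And>i. i \<in> I \<Longrightarrow> bij_betw (h i) (A i) (B i)"
  shows "bij_betw (\<lambda>f. \<lambda>i\<in>I. h i (f i)) (Pi\<^sub>E I A) (Pi\<^sub>E I B)"
proof (rule bij_betw_byWitness[where f' = "\<lambda>g. \<lambda>i\<in>I. inv_into (A i) (h i) (g i)"], goal_cases)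
  case 1
  show ?case
  proof (intro ballI ext)
    fix f i assume f: "f \<in> Pi\<^sub>E I A"
    show "(\<lambda>i\<in>I. inv_into (A i) (h i) ((\<lambda>i\<in>I. h i (f i)) i)) i = f i"
    proof (cases "i \<in> I")
      case True
      with bij_betw_inv_into_left[OF assms[OF True] PiE_mem[OF f True]] show ?thesis by simp
    next
      case False
      with PiE_arb[OF f False] show ?thesis by simp
    qed
  qed
next
  case 2
  show ?case
  proof (intro ballI ext)
    fix g i assume g: "g \<in> Pi\<^sub>E I B"
    show "(\<lambda>i\<in>I. h i ((\<lambda>i\<in>I. inv_into (A i) (h i) (g i)) i)) i = g i"
    proof (cases "i \<in> I")
      case True
      with bij_betw_inv_into_right[OF assms[OF True] PiE_mem[OF g True]] show ?thesis by simp
    next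
      case False
      with PiE_arb[OF g False] show ?thesis by simp
    qed
  qed
next
  case 3
  have "h i (f i) \<in> B i" if "f \<in> Pi\<^sub>E I A" "i \<in> I" for f i
    by (rule bij_betw_apply[OF assms[OF that(2)] PiE_mem[OF that]])
  then show ?case by (intro image_subsetI restrict_PiE_iff[THEN iffD2] ballI)
next
  case 4
  have "inv_into (A i) (h i) (g i) \<in> A i" if "g \<in> Pi\<^sub>E I B" "i \<in> I" for g i
    by (rule bij_betw_apply[OF bij_betw_inv_into[OF assms[OF that(2)]] PiE_mem[OF that]])
  then show ?case by (intro image_subsetI restrict_PiE_iff[THEN iffD2] ballI)
qed

section \<open>Linear extension from generators to formal combinations\<close>

text \<open>This is the linear functional sending each generator \<open>point_fun t\<close> to
  \<open>m t\<close>. On an infinite support the sum defaults to 0, so linearity is claimed only for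
  finite supports.\<close>

definition finsupp_eval :: "('a \<Rightarrow> 'k::field) \<Rightarrow> ('a \<Rightarrow> 'k) \<Rightarrow> 'k" where
  "finsupp_eval m f = (\<Sum>t | f t \<noteq> 0. f t * m t)"

lemma finsupp_eval_superset:
  assumes "finite S" "{t. f t \<noteq> 0} \<subseteq> S"
  shows "finsupp_eval m f = (\<Sum>t\<in>S. f t * m t)"
  unfolding finsupp_eval_def by (rule sum.mono_neutral_left) (use assms in auto)

lemma finite_support_point_fun: "finite {t. (point_fun a :: 'a \<Rightarrow> 'k::field) t \<noteq> 0}"
  by (simp add: point_fun_def)

lemma finite_support_add:
  fixes f g :: "'a \<Rightarrow> 'k::field"
  assumes "finite {t. f t \<noteq> 0}" "finite {t. g t \<noteq> 0}"
  shows "finite {t. (f + g) t \<noteq> 0}"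
  by (rule finite_subset[OF _ finite_UnI[OF assms]]) auto

lemma finite_support_scale:
  fixes f :: "'a \<Rightarrow> 'k::field"
  assumes "finite {t. f t \<noteq> 0}"
  shows "finite {t. fun_scale c f t \<noteq> 0}"
  by (rule finite_subset[OF _ assms]) (auto simp: fun_scale_def)

lemma finite_support_diff:
  fixes f g :: "'a \<Rightarrow> 'k::field"
  assumes "finite {t. f t \<noteq> 0}" "finite {t. g t \<noteq> 0}"
  shows "finite {t. (f - g) t \<noteq> 0}"
  by (rule finite_subset[OF _ finite_UnI[OF assms]]) auto

lemma finsupp_eval_point_fun: "finsupp_eval m (point_fun a) = m a"
  by (subst finsupp_eval_superset[of "{a}"]) (auto simp: point_fun_def)

lemma finsupp_eval_add:
  assumes "finite {t. f t \<noteq> 0}" "finite {t. g t \<noteq> 0}"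
  shows "finsupp_eval m (f + g) = finsupp_eval m f + finsupp_eval m g"
proof -
  have fin: "finite ({t. f t \<noteq> 0} \<union> {t. g t \<noteq> 0})" using assms by simp
  show ?thesis
    by (subst (1 2 3) finsupp_eval_superset[OF fin])
       (auto simp: sum.distrib[symmetric] algebra_simps)
qed

lemma finsupp_eval_scale:
  assumes "finite {t. f t \<noteq> 0}"
  shows "finsupp_eval m (fun_scale c f) = c * finsupp_eval m f"
  by (subst (1 2) finsupp_eval_superset[OF assms])
     (auto simp: fun_scale_def sum_distrib_left algebra_simps)

lemma finsupp_eval_diff:
  assumes "finite {t. f t \<noteq> 0}" "finite {t. g t \<noteq> 0}"
  shows "finsupp_eval m (f - g) = finsupp_eval m f - finsupp_eval m g"
  by (metis finsupp_eval_add[OF finite_support_diff[OF assms] assms(2)] diff_add_cancel eq_diff_eq)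

text \<open>Finiteness of the support is part of the conclusion because the induction step needs it
  to apply additivity to the partial sum.\<close>

lemma finsupp_eval_sum:
  assumes "finite S" "\<And>x. x \<in> S \<Longrightarrow> finite {t. f x t \<noteq> 0}"
  shows "finite {t. (\<Sum>x\<in>S. f x) t \<noteq> 0} \<and>
         finsupp_eval m (\<Sum>x\<in>S. f x) = (\<Sum>x\<in>S. finsupp_eval m (f x))"
  using assms
proof (induction S rule: finite_induct)
  case empty
  then show ?case by (simp add: finsupp_eval_def)
next
  case (insert x S)
  then show ?case
    by (simp only: sum.insert finsupp_eval_add finite_support_add insert_iff simp_thms)
qed

text \<open>Replacing entry \<open>i\<close> of a tuple changes a single factor of the product, and
  that factor depends linearly on the entry. So the functional kills every multilinear relation, and
  its kernel contains their span.\<close>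

lemma coordinate_vanishes_on_relations:
  assumes "finite I" and "r \<in> fun_vs.span (multilinear_relations I V)"
  shows "finsupp_eval (\<lambda>t. \<Prod>i\<in>I. t i (x i)) r = 0"
proof -
  define m :: "('a \<Rightarrow> 'b \<Rightarrow> 'c) \<Rightarrow> 'c" where "m = (\<lambda>t. \<Prod>i\<in>I. t i (x i))"
  have upd: "m (t(i := v)) = v (x i) * (\<Prod>j\<in>I - {i}. t j (x j))" if "i \<in> I" for t i v
    using assms(1) that by (auto simp: m_def prod.remove[of I i] intro!: prod.cong)
  \<comment> \<open>The kernel is cut down to finite supports, where additivity of
    \<open>finsupp_eval m\<close> is available to make it a subspace.\<close>
  let ?K = "{f. finite {t. f t \<noteq> 0} \<and> finsupp_eval m f = 0}"
  have "multilinear_relations I V \<subseteq> ?K"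
    unfolding multilinear_relations_def
    by (auto simp only: mem_Collect_eq finsupp_eval_diff finsupp_eval_scale finite_support_diff
          finite_support_scale finite_support_point_fun finsupp_eval_point_fun upd)
       (simp_all add: fun_scale_def algebra_simps)
  moreover have "fun_vs.subspace ?K"
    by (rule fun_vs.subspaceI)
       (auto simp: finsupp_eval_add finsupp_eval_scale finite_support_scale
         finite_support_add[unfolded plus_fun_apply], simp add: finsupp_eval_def)
  ultimately have "fun_vs.span (multilinear_relations I V) \<subseteq> ?K"
    by (rule fun_vs.span_minimal)
  then show ?thesis using assms(2) by (auto simp: m_def)
qed

section \<open>Basis tensors and expansion of pure tensors\<close>

definition basis_tuple :: "'i set \<Rightarrow> ('i \<Rightarrow> 'a) \<Rightarrow> 'i \<Rightarrow> 'a \<Rightarrow> 'k::field" where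
  "basis_tuple I x = (\<lambda>i\<in>I. point_fun (x i))"

lemma point_fun_eq_iff: "(point_fun a :: 'a \<Rightarrow> 'k::field) = point_fun b \<longleftrightarrow> a = b"
  by (metis point_fun_def zero_neq_one)

text \<open>Needed to turn a sum over the set of basis generators into a sum over multi-indices
  without collapsing terms.\<close>

lemma inj_on_basis_tuple:
  "inj_on (\<lambda>x. point_fun (basis_tuple I x :: 'i \<Rightarrow> 'a \<Rightarrow> 'k::field) :: _ \<Rightarrow> 'k) (Pi\<^sub>E I A)"
proof (rule inj_onI)
  fix x y
  assume x: "x \<in> Pi\<^sub>E I A" and y: "y \<in> Pi\<^sub>E I A"
    and "(point_fun (basis_tuple I x :: 'i \<Rightarrow> 'a \<Rightarrow> 'k) :: _ \<Rightarrow> 'k) = point_fun (basis_tuple I y)"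
  then have eq: "(basis_tuple I x :: 'i \<Rightarrow> 'a \<Rightarrow> 'k) = basis_tuple I y"
    by (simp only: point_fun_eq_iff)
  show "x = y"
  proof (rule PiE_ext[OF x y])
    fix i assume "i \<in> I"
    then show "x i = y i"
      using fun_cong[OF eq, of i] by (simp add: basis_tuple_def point_fun_eq_iff)
  qed
qed

lemma point_fun_in_coord_space: "a \<in> A \<Longrightarrow> point_fun a \<in> coord_space A"
  by (auto simp: point_fun_def coord_space_def)

lemma basis_tuple_in_PiE:
  "x \<in> Pi\<^sub>E I A \<Longrightarrow> basis_tuple I x \<in> Pi\<^sub>E I (\<lambda>i. coord_space (A i))"
  by (auto simp: basis_tuple_def intro!: point_fun_in_coord_space)

lemma subspace_coord_space: "fun_vs.subspace (coord_space A :: ('a \<Rightarrow> 'k::field) set)"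
  by (rule fun_vs.subspaceI) (auto simp: coord_space_def fun_scale_def)

lemma coord_space_eq_span:
  assumes "finite A"
  shows "coord_space A = fun_vs.span (point_fun ` A :: ('a \<Rightarrow> 'k::field) set)"
proof
  show "coord_space A \<subseteq> fun_vs.span (point_fun ` A :: ('a \<Rightarrow> 'k) set)"
  proof
    fix v :: "'a \<Rightarrow> 'k" assume v: "v \<in> coord_space A"
    have "(\<Sum>a\<in>S. fun_scale (v a) (point_fun a)) b = (if b \<in> S then v b else 0)"
      if "finite S" for S b
      using that by induction (auto simp: fun_scale_def point_fun_def)
    with assms v have "v = (\<Sum>a\<in>A. fun_scale (v a) (point_fun a))"
      by (auto simp: coord_space_def)
    then show "v \<in> fun_vs.span (point_fun ` A)"
      by (metis (no_types, lifting) fun_vs.span_sum fun_vs.span_scale fun_vs.span_base imageI)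
  qed
  show "fun_vs.span (point_fun ` A :: ('a \<Rightarrow> 'k) set) \<subseteq> coord_space A"
    by (rule fun_vs.span_minimal[OF _ subspace_coord_space])
       (auto intro: point_fun_in_coord_space)
qed

text \<open>The entries of \<open>t\<close> are expanded in the standard basis one position at a
  time. The induction runs over the set \<open>J\<close> of positions whose entries may still be
  arbitrary vectors.\<close>

lemma pure_tensors_in_span:
  fixes A :: "'i \<Rightarrow> 'a set" and t :: "'i \<Rightarrow> 'a \<Rightarrow> 'k::field"
  defines "V \<equiv> \<lambda>i. coord_space (A i) :: ('a \<Rightarrow> 'k) set"
  assumes "finite I" "\<And>i. i \<in> I \<Longrightarrow> finite (A i)" and "t \<in> Pi\<^sub>E I V"
  shows "point_fun t \<in> fun_vs.span (multilinear_relations I V \<union>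
           (\<lambda>x. point_fun (basis_tuple I x)) ` Pi\<^sub>E I A)"
    (is "_ \<in> ?Q")
proof -
  have "point_fun t \<in> ?Q"
    if "finite J" "J \<subseteq> I" "t \<in> Pi\<^sub>E I V" "\<forall>i\<in>I - J. t i \<in> point_fun ` A i" for J t
    using that
  proof (induction J arbitrary: t rule: finite_induct)
    case empty
    then have "\<forall>i\<in>I. \<exists>a. a \<in> A i \<and> t i = point_fun a" by auto
    then obtain x where x: "\<And>i. i \<in> I \<Longrightarrow> x i \<in> A i \<and> t i = point_fun (x i)" by metis
    have "t = basis_tuple I (restrict x I)"
    proof
      fix i show "t i = basis_tuple I (restrict x I) i"
        using x[of i] PiE_arb[OF empty.prems(2), of i] by (cases "i \<in> I") (simp_all add: basis_tuple_def)
    qed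
    \<comment> \<open>The choice of \<open>x\<close> says nothing off \<open>I\<close>, so it is
      restricted to become an extensional multi-index.\<close>
    moreover have "restrict x I \<in> Pi\<^sub>E I A" using x by auto
    ultimately show ?case by (auto intro!: fun_vs.span_base)
  next
    case (insert j J)
    then have j: "j \<in> I" by simp
    \<comment> \<open>The admissible entries at position \<open>j\<close>. The relations make them a
      subspace and the induction hypothesis puts the standard basis vectors among them, so they fill
      \<open>V j\<close>; in particular \<open>t j\<close> is admissible.\<close>
    let ?W = "{v \<in> V j. point_fun (t(j := v)) \<in> ?Q}"
    have add: "point_fun (t(j := v + w)) - point_fun (t(j := v)) - point_fun (t(j := w)) \<in> ?Q"
      if "v \<in> V j" "w \<in> V j" for v w
      using insert.prems j that
      by (intro fun_vs.span_base UnI1, unfold multilinear_relations_def) blast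
    have scale: "point_fun (t(j := fun_scale c v)) - fun_scale c (point_fun (t(j := v))) \<in> ?Q"
      if "v \<in> V j" for c v
      using insert.prems j that
      by (intro fun_vs.span_base UnI1, unfold multilinear_relations_def) blast
    have sub: "fun_vs.subspace (V j)" by (simp add: V_def subspace_coord_space)
    have scaleW: "fun_scale c v \<in> V j" "point_fun (t(j := fun_scale c v)) \<in> ?Q \<longleftrightarrow>
        fun_scale c (point_fun (t(j := v))) \<in> ?Q"
      if "v \<in> V j" for c v
      using scale[OF that, of c] fun_vs.subspace_scale[OF sub that]
      by (auto simp: fun_vs.span_add_eq dest: fun_vs.span_add fun_vs.span_diff)
    have "fun_vs.subspace ?W"
    proof (rule fun_vs.subspaceI)
      have zero: "0 \<in> V j" using fun_vs.subspace_0[OF sub] .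
      \<comment> \<open>A generator with a zero entry is not the zero combination; homogeneity with
        scalar 0 puts it into the span.\<close>
      show "0 \<in> ?W"
        using scaleW(2)[OF zero, of 0] zero by (simp add: fun_vs.span_zero)
    next
      fix v w assume vw: "v \<in> ?W" "w \<in> ?W"
      then have "point_fun (t(j := v + w)) - point_fun (t(j := v)) - point_fun (t(j := w)) +
          point_fun (t(j := w)) + point_fun (t(j := v)) \<in> ?Q"
        by (intro fun_vs.span_add add) auto
      then show "v + w \<in> ?W" using vw fun_vs.subspace_add[OF sub] by simp
    next
      fix c v assume "v \<in> ?W"
      then show "fun_scale c v \<in> ?W" using scaleW fun_vs.span_scale by blast
    qed
    moreover have "point_fun ` A j \<subseteq> ?W"
    proof safe
      fix a assume a: "a \<in> A j"
      then show aV: "point_fun a \<in> V j" by (simp add: V_def point_fun_in_coord_space)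
      \<comment> \<open>Position \<open>j\<close> now holds a basis vector, so only the positions in
        \<open>J\<close> remain arbitrary.\<close>
      show "point_fun (t(j := point_fun a)) \<in> ?Q"
        using insert.prems a aV j by (intro insert.IH) (auto simp: PiE_iff extensional_def)
    qed
    ultimately have "V j \<subseteq> ?W"
      unfolding V_def coord_space_eq_span[OF assms(3)[OF j]]
      by (intro fun_vs.span_minimal)
    moreover have "t j \<in> V j" using insert.prems j by auto
    ultimately show ?case by auto
  qed
  from this[OF assms(2) subset_refl assms(4)] show ?thesis by simp
qed

section \<open>Functions as coordinates of tensors\<close>

lemma equiv_tensor_rel: "equiv (free_space I V) (tensor_rel I V)"
proof (rule equivI)
  show "refl_on (free_space I V) (tensor_rel I V)"
    by (auto simp: refl_on_def tensor_rel_def fun_vs.span_zero)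
  show "sym (tensor_rel I V)"
  proof (rule symI)
    fix f g assume "(f, g) \<in> tensor_rel I V"
    then show "(g, f) \<in> tensor_rel I V"
      using fun_vs.span_neg[of "f - g"] by (auto simp: tensor_rel_def)
  qed
  show "trans (tensor_rel I V)"
  proof (rule transI)
    fix f g h assume "(f, g) \<in> tensor_rel I V" "(g, h) \<in> tensor_rel I V"
    then show "(f, h) \<in> tensor_rel I V"
      using fun_vs.span_add[of "f - g" _ "g - h"] by (auto simp: tensor_rel_def)
  qed
qed (auto simp: tensor_rel_def)

text \<open>Coordinate functionals recover \<open>f\<close> from its class, and every class has a
  representative in the span of the basis generators. The domain is extensional because
  \<open>tensor_of_fun\<close> sees only the values of \<open>f\<close> on
  \<open>Pi\<^sub>E I A\<close>.\<close>

theorem bij_betw_tensor_of_fun: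
  fixes A :: "'i \<Rightarrow> 'a set"
  assumes "finite I" "\<And>i. i \<in> I \<Longrightarrow> finite (A i)"
  shows "bij_betw (tensor_of_fun I A) (Pi\<^sub>E I A \<rightarrow>\<^sub>E (UNIV :: 'k::field set))
           (tensor_product I (\<lambda>i. coord_space (A i)))"
proof -
  define V :: "'i \<Rightarrow> ('a \<Rightarrow> 'k) set" where "V = (\<lambda>i. coord_space (A i))"
  define b :: "('i \<Rightarrow> 'a) \<Rightarrow> ('i \<Rightarrow> 'a \<Rightarrow> 'k) \<Rightarrow> 'k" where "b = (\<lambda>x. point_fun (basis_tuple I x))"
  define s where "s f = (\<Sum>x\<in>Pi\<^sub>E I A. fun_scale (f x) (b x))" for f
  let ?N = "fun_vs.span (multilinear_relations I V)"
  have fin: "finite (Pi\<^sub>E I A)" using assms by (rule finite_PiE)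
  have tof: "tensor_of_fun I A f = tensor_rel I V `` {s f}" for f
    by (simp add: tensor_of_fun_def s_def V_def b_def basis_tuple_def)
  have sF: "s f \<in> free_space I V" for f
    unfolding s_def free_space_def b_def V_def
    by (intro fun_vs.span_sum fun_vs.span_scale fun_vs.span_base imageI basis_tuple_in_PiE)
  \<comment> \<open>On the basis tuple of \<open>y\<close> the functional of \<open>x\<close> is a
    product of Kronecker deltas, so only the term \<open>y = x\<close> of \<open>s f\<close>
    survives.\<close>
  have coord: "finite {t. s f t \<noteq> 0} \<and> finsupp_eval (\<lambda>t. \<Prod>i\<in>I. t i (x i)) (s f) = f x"
    if x: "x \<in> Pi\<^sub>E I A" for f x
  proof -
    have delta: "(\<Prod>i\<in>I. (basis_tuple I y :: 'i \<Rightarrow> 'a \<Rightarrow> 'k) i (x i)) = (if y = x then 1 else 0)"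
      if y: "y \<in> Pi\<^sub>E I A" for y
    proof (cases "y = x")
      case False
      then obtain i where "i \<in> I" "y i \<noteq> x i" using PiE_ext[OF y x] by blast
      then show ?thesis
        using assms(1) False by (auto simp: basis_tuple_def point_fun_def prod_zero_iff)
    qed (simp add: basis_tuple_def point_fun_def)
    have supp: "finite {t. fun_scale (f y) (b y) t \<noteq> 0}" for y
      unfolding b_def by (intro finite_support_scale finite_support_point_fun)
    have "finsupp_eval (\<lambda>t. \<Prod>i\<in>I. t i (x i)) (fun_scale (f y) (b y)) =
        (if y = x then f x else 0)" if "y \<in> Pi\<^sub>E I A" for y
      using delta[OF that] unfolding b_def
      by (simp add: finsupp_eval_scale finite_support_point_fun finsupp_eval_point_fun)
    then show ?thesis
      using finsupp_eval_sum[OF fin supp] x fin unfolding s_def by simp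
  qed
  have "inj_on (tensor_of_fun I A) (Pi\<^sub>E I A \<rightarrow>\<^sub>E (UNIV :: 'k set))"
  proof (rule inj_onI)
    fix f g :: "('i \<Rightarrow> 'a) \<Rightarrow> 'k"
    assume f: "f \<in> Pi\<^sub>E I A \<rightarrow>\<^sub>E UNIV" and g: "g \<in> Pi\<^sub>E I A \<rightarrow>\<^sub>E UNIV"
      and "tensor_of_fun I A f = tensor_of_fun I A g"
    then have "(s f, s g) \<in> tensor_rel I V"
      using eq_equiv_class[OF _ equiv_tensor_rel sF] by (simp add: tof)
    then have diff: "s f - s g \<in> ?N" by (simp add: tensor_rel_def)
    have "f x = g x" if x: "x \<in> Pi\<^sub>E I A" for x
    proof -
      have "f x - g x = finsupp_eval (\<lambda>t. \<Prod>i\<in>I. t i (x i)) (s f - s g)"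
        using finsupp_eval_diff[OF conjunct1[OF coord[OF x, of f]] conjunct1[OF coord[OF x, of g]]]
        by (simp only: conjunct2[OF coord[OF x]])
      also have "\<dots> = 0"
        by (rule coordinate_vanishes_on_relations[OF assms(1) diff])
      finally show ?thesis by simp
    qed
    then show "f = g" by (rule PiE_ext[OF f g])
  qed
  moreover have "tensor_of_fun I A f \<in> tensor_product I V" for f
    unfolding tof tensor_product_def using sF by (rule quotientI)
  moreover have "\<exists>f\<in>Pi\<^sub>E I A \<rightarrow>\<^sub>E UNIV. T = tensor_of_fun I A f"
    if "T \<in> tensor_product I V" for T
  proof -
    from that obtain g where g: "g \<in> free_space I V" and T: "T = tensor_rel I V `` {g}"
      unfolding tensor_product_def by (rule quotientE)
    have "free_space I V \<subseteq> fun_vs.span (multilinear_relations I V \<union> b ` Pi\<^sub>E I A)"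
      unfolding free_space_def V_def b_def
      using pure_tensors_in_span[OF assms]
      by (intro fun_vs.span_minimal fun_vs.subspace_span) auto
    \<comment> \<open>The part \<open>r\<close> vanishes in the quotient, so \<open>e\<close>
      represents the same tensor as \<open>g\<close>; its coefficients provide the preimage of
      \<open>T\<close>.\<close>
    with g obtain r e where r: "r \<in> ?N" and e: "e \<in> fun_vs.span (b ` Pi\<^sub>E I A)" and "g = r + e"
      unfolding fun_vs.span_Un by blast
    from e obtain c where "e = (\<Sum>v\<in>b ` Pi\<^sub>E I A. fun_scale (c v) v)"
      using fun_vs.span_finite[OF finite_imageI[OF fin], of b] by auto
    also have "\<dots> = s (\<lambda>x\<in>Pi\<^sub>E I A. c (b x))"
      using inj_on_basis_tuple[of I A, where 'k='k]
      by (simp add: s_def b_def sum.reindex)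
    finally have "(g, s (\<lambda>x\<in>Pi\<^sub>E I A. c (b x))) \<in> tensor_rel I V"
      using r g sF \<open>g = r + e\<close> by (simp add: tensor_rel_def)
    then have "T = tensor_of_fun I A (\<lambda>x\<in>Pi\<^sub>E I A. c (b x))"
      unfolding T tof by (rule equiv_class_eq[OF equiv_tensor_rel])
    then show ?thesis
      by (rule bexI[of "\<lambda>f. T = tensor_of_fun I A f"]) (rule iffD2[OF restrict_PiE_iff], simp)
  qed
  ultimately show ?thesis unfolding V_def[symmetric] bij_betw_def by blast
qed

section \<open>Passage to the dual hypergraph, clique by clique\<close>

theorem theorem2p1:
  fixes H :: "('u, 'c) hypergraph" and X :: "'u \<Rightarrow> 'x set"
  assumes "finite_hypergraph H"
    and "\<And>u. u \<in> verts H \<Longrightarrow> finite (X u) \<and> X u \<noteq> {}"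
  shows "bij_betw
      (\<lambda>\<psi>. \<lambda>C\<in>hyperedges H. tensor_of_fun (members H C) X (\<psi> C))
      (clique_potentials H X :: ('c \<Rightarrow> ('u \<Rightarrow> 'x) \<Rightarrow> 'k::field) set)
      (tensor_hypernetworks (dual H) (\<lambda>u. card (X u)) X)"
proof -
  have members: "finite (members H C)" "members H C \<subseteq> verts H" if "C \<in> hyperedges H" for C
    using assms(1) that by (auto simp: finite_hypergraph_def intro: finite_subset)
  \<comment> \<open>The dual hyperedges through \<open>C\<close> are by definition the vertices of
    \<open>H\<close> lying in \<open>C\<close>; every member of \<open>C\<close> is counted since
    \<open>members H C \<subseteq> verts H\<close>.\<close>
  have incident: "incident (dual H) C = members H C" if "C \<in> hyperedges H" for C
    using members(2)[OF that] that by (auto simp: incident_def dual_def)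
  have "tensor_hypernetworks (dual H) (\<lambda>u. card (X u)) X =
      ((\<Pi>\<^sub>E C\<in>hyperedges H. tensor_product (members H C) (\<lambda>u. coord_space (X u)))
        :: ('c \<Rightarrow> (('u \<Rightarrow> 'x \<Rightarrow> 'k) \<Rightarrow> 'k) set) set)"
  proof -
    have "(\<Pi>\<^sub>E C\<in>hyperedges H. tensor_product (incident (dual H) C) (\<lambda>u. coord_space (X u)))
        = ((\<Pi>\<^sub>E C\<in>hyperedges H. tensor_product (members H C) (\<lambda>u. coord_space (X u)))
          :: ('c \<Rightarrow> (('u \<Rightarrow> 'x \<Rightarrow> 'k) \<Rightarrow> 'k) set) set)"
      by (rule PiE_cong) (simp add: incident)
    moreover have "verts (dual H) = hyperedges H" "hyperedges (dual H) = verts H"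
      by (simp_all add: dual_def)
    \<comment> \<open>The side conditions on the sizes hold for every family:
      \<open>card (X u)\<close> is positive because \<open>X u\<close> is finite and
      nonempty.\<close>
    ultimately show ?thesis
      using assms(2) finite_hypergraph_dual[OF assms(1)]
      by (simp add: tensor_hypernetworks_def card_gt_0_iff)
  qed
  moreover have "bij_betw (tensor_of_fun (members H C) X)
      ((\<Pi>\<^sub>E u\<in>members H C. X u) \<rightarrow>\<^sub>E (UNIV :: 'k set))
      (tensor_product (members H C) (\<lambda>u. coord_space (X u)))" if "C \<in> hyperedges H" for C
    using members[OF that] assms(2) by (intro bij_betw_tensor_of_fun) auto
  ultimately show ?thesis
    unfolding clique_potentials_def by (simp only:) (rule bij_betw_PiE_pointwise)
qed

end
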